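(* Let $v\in\mathcal{G}^{N,\mathcal{A}}$ be a game and $\mathbf{u}$ a utility function such that $v$ is $\mathbf{u}$-balanced. Let $t_k$, $X_k$, $W_k$ be the numbers, sets of preimputations and sets of coalitions produced by the iterative scheme described in the context, and put $$Y_1=\{x\in I^*(v) : u_S(e(S,x))\le t_1\ \ \forall S\in\mathcal{E}_v^{\mathbf{u}}\},$$ and, for $k\ge 2$, $$Y_k=\{x\in X_{k-1} : u_S(e(S,x))\le t_k\ \ \forall S\in\mathcal{E}_v^{\mathbf{u}}\setminus(\textstyle\bigcup_{r=1}^{k-1}W_r)\}.$$ Then $X_k=Y_k$ for every $k\ge 1$ (for which the scheme is defined up to step $k$).
   Context: $N$ is a nonempty finite set of players. $\mathcal{A}\subseteq 2^N$ is a family of feasible coalitions with $\emptyset,N\in\mathcal{A}$; $\mathcal{A}^*=\mathcal{A}\setminus\{\emptyset,N\}$, assumed nonempty. $\mathcal{G}^{N,\mathcal{A}}$ is the set of games, i.e. functions $v:\mathcal{A}\to\mathbb{R}$ with $v(\emptyset)=0$. For $x\in\mathbb{R}^N$, $x(S)=\sum_{i\in S}x_i$; the excess is $e(S,x)=v(S)-x(S)$; $I^*(v)=\{x\in\mathbb{R}^N: x(N)=v(N)\}$ is the set of preimputations. A utility function $\mathbf{u}$ is a family $(u_S)_{S\in\mathcal{A}^*}$ of strictly increasing continuous functions $u_S:\mathbb{R}\to\mathbb{R}$, all having the same range, denoted $R_{\mathbf{u}}$. The $\mathbf{u}$-core is $\mathbf{u}\text{-core}(v)=\{x\in\mathbb{R}^N: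 x(N)=v(N),\ u_S(e(S,x))\le 0\ \forall S\in\mathcal{A}^*\}$. A family $\mathcal{B}\subseteq\mathcal{A}\setminus\{\emptyset\}$ is balanced if there are weights $\lambda_S\ge 0$ ($S\in\mathcal{B}$), called a balancing weight system, with $\sum_{S\in\mathcal{B}}\lambda_S\chi_S=\chi_N$, where $\chi_T\in\mathbb{R}^N$ is the characteristic vector of $T$. The game $v$ is $\mathbf{u}$-balanced if either $R_{\mathbf{u}}\subseteq(-\infty,0)$, or $0\in R_{\mathbf{u}}$ and $$\max\Big(\lambda_N v(N)+\sum_{S\in\mathcal{B}\setminus\{N\}}\lambda_S\,(v(S)-u_S^{-1}(0))\Big)\le v(N),$$ the maximum being over all balanced families $\mathcal{B}\subseteq\mathcal{A}\setminus\{\emptyset\}$ and all their balancing weight systems $(\lambda_S)_{S\in\mathcal{B}}$ (with $\lambda_N=0$ if $N\notin\mathcal{B}$). For $S\in\mathcal{A}^*$, $\mathcal{D}_S^{\mathcal{A}^*}$ is the set of all partitions of $S$, other than $\{S\}$, all of whose members belong to $\mathcal{A}^*$. A coalition $S\in\mathcal{A}^*$ is $\mathbf{u}$-essential if either $\mathcal{D}_S^{\mathcal{A}^*}=\emptyset$ or there exists $x\in\mathbf{u}\text{-core}(v)$ with $u_S(e(S,x))>\max_{\mathcal{B}\in\mathcal{D}_S^{\mathcal{A}^*}}\sum_{T\in\mathcal{B}}u_T(e(T,x))$. $\mathcal{E}_v^{\mathbf{u}}$ is the set of $\mathbf{u}$-essential coalitions. Iterative scheme. Step 1: $t_1$ is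 the optimum (assumed to exist) of: minimize $t\in R_{\mathbf{u}}$ subject to $u_S(e(S,x))\le t$ for all $S\in\mathcal{A}^*$, $x\in I^*(v)$. Put $X_1=\{x\in I^*(v): u_S(e(S,x))\le t_1\ \forall S\in\mathcal{A}^*\}$ and $W_1=\{S\in\mathcal{A}^*: \exists c_S\in\mathbb{R},\ u_S(e(S,x))=c_S\ \forall x\in X_1\}$. Step $k\ge2$: $t_k$ is the optimum (assumed to exist when $\mathcal{A}^*\setminus\bigcup_{r=1}^{k-1}W_r\ne\emptyset$) of: minimize $t\in\mathbb{R}$ subject to $u_S(e(S,x))\le t$ for all $S\in\mathcal{A}^*\setminus\bigcup_{r=1}^{k-1}W_r$, $x\in X_{k-1}$. Put $X_k=\{x\in X_{k-1}: u_S(e(S,x))\le t_k\ \forall S\in\mathcal{A}^*\setminus\bigcup_{r=1}^{k-1}W_r\}$ and $W_k=\{S\in\mathcal{A}^*: \exists c_S\in\mathbb{R},\ u_S(e(S,x))=c_S\ \forall x\in X_k\}$. If $\mathcal{A}^*\setminus\bigcup_{r=1}^{k-1}W_r=\emptyset$, the conditions involving $t_k$ are vacuous, so $X_k=Y_k=X_{k-1}$. The scheme is defined up to step $k$ if all the required optima $t_1,\dots,t_k$ exist. *)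

theory Defs
  imports "HOL-Analysis.Analysis" "HOL-Library.Disjoint_Sets"
begin

text \<open>
  The set of players is the universe of a finite type \<open>'n\<close> (nonempty, as every type is).
  A feasible family is a set \<open>A :: 'n set set\<close>.  Games and utility functions are total functions on
  all coalitions, but only their values on \<open>A\<close>, respectively on \<open>proper A\<close>, are ever used.
\<close>

definition proper :: "'n set set \<Rightarrow> 'n set set" where
  "proper A = A - {{}, UNIV}"

definition feasible_family :: "'n set set \<Rightarrow> bool" where
  "feasible_family A \<longleftrightarrow> {} \<in> A \<and> UNIV \<in> A \<and> proper A \<noteq> {}"

definition payoff :: "real ^ 'n \<Rightarrow> 'n::finite set \<Rightarrow> real" where
  "payoff x S = (\<Sum>i\<in>S. x $ i)"

definition excess :: "('n::finite set \<Rightarrow> real) \<Rightarrow> 'n set \<Rightarrow> real ^ 'n \<Rightarrow> real" where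
  "excess v S x = v S - payoff x S"

definition preimputations :: "('n::finite set \<Rightarrow> real) \<Rightarrow> (real ^ 'n) set" where
  "preimputations v = {x. payoff x UNIV = v UNIV}"

definition utility :: "'n set set \<Rightarrow> ('n set \<Rightarrow> real \<Rightarrow> real) \<Rightarrow> bool" where
  "utility A u \<longleftrightarrow>
     (\<forall>S\<in>proper A. strict_mono (u S) \<and> continuous_on UNIV (u S)) \<and>
     (\<forall>S\<in>proper A. \<forall>T\<in>proper A. range (u S) = range (u T))"

text \<open>For a utility function all the ranges below coincide, so that the union is the common range.\<close>

definition utility_range :: "'n set set \<Rightarrow> ('n set \<Rightarrow> real \<Rightarrow> real) \<Rightarrow> real set" where
  "utility_range A u = (\<Union>S\<in>proper A. range (u S))"

definition u_core ::
  "'n::finite set set \<Rightarrow> ('n set \<Rightarrow> real) \<Rightarrow> ('n set \<Rightarrow> real \<Rightarrow> real) \<Rightarrow> (real ^ 'n) set" where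
  "u_core A v u =
     {x. payoff x UNIV = v UNIV \<and> (\<forall>S\<in>proper A. u S (excess v S x) \<le> 0)}"

definition char_vec :: "'n::finite set \<Rightarrow> real ^ 'n" where
  "char_vec S = (\<chi> i. indicator S i)"

definition balancing_weights :: "'n::finite set set \<Rightarrow> ('n set \<Rightarrow> real) \<Rightarrow> bool" where
  "balancing_weights B wt \<longleftrightarrow>
     (\<forall>S\<in>B. 0 \<le> wt S) \<and> (\<Sum>S\<in>B. wt S *\<^sub>R char_vec S) = char_vec UNIV"

definition balanced_values ::
  "'n::finite set set \<Rightarrow> ('n set \<Rightarrow> real) \<Rightarrow> ('n set \<Rightarrow> real \<Rightarrow> real) \<Rightarrow> real set" where
  "balanced_values A v u =
     {(if UNIV \<in> B then wt UNIV else 0) * v UNIV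
        + (\<Sum>S\<in>B - {UNIV}. wt S * (v S - inv (u S) 0)) | B wt.
      B \<subseteq> A - {{}} \<and> balancing_weights B wt}"

text \<open>The supremum below is a maximum whenever \<open>UNIV \<in> A\<close>; see \<open>Sup_balanced_values\<close>.\<close>

definition u_balanced ::
  "'n::finite set set \<Rightarrow> ('n set \<Rightarrow> real) \<Rightarrow> ('n set \<Rightarrow> real \<Rightarrow> real) \<Rightarrow> bool" where
  "u_balanced A v u \<longleftrightarrow>
     utility_range A u \<subseteq> {..<0} \<or>
     (0 \<in> utility_range A u \<and> Sup (balanced_values A v u) \<le> v UNIV)"

lemma Sup_balanced_values:
  fixes A :: "'n::finite set set"
  assumes "UNIV \<in> A"
  shows "Sup (balanced_values A v u) \<in> balanced_values A v u"
    and "\<forall>y \<in> balanced_values A v u. y \<le> Sup (balanced_values A v u)"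
proof -
  define g where "g B w = (if UNIV \<in> B then w $ UNIV else 0) * v UNIV
        + (\<Sum>S\<in>B - {UNIV}. w $ S * (v S - inv (u S) 0))"
    for B :: "'n set set" and w :: "real ^ ('n set)"
  define K where "K B = {w :: real ^ ('n set). (\<forall>S. 0 \<le> w $ S) \<and> (\<forall>S. S \<notin> B \<longrightarrow> w $ S = 0)
        \<and> (\<Sum>S\<in>B. w $ S *\<^sub>R char_vec S) = char_vec UNIV}" for B :: "'n set set"
  have eq: "balanced_values A v u = (\<Union>B\<in>Pow (A - {{}}). g B ` K B)"
  proof (intro set_eqI iffI)
    fix y assume "y \<in> balanced_values A v u"
    then obtain B l where B: "B \<subseteq> A - {{}}" and l: "balancing_weights B l"
      and y: "y = (if UNIV \<in> B then l UNIV else 0) * v UNIV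
        + (\<Sum>S\<in>B - {UNIV}. l S * (v S - inv (u S) 0))"
      unfolding balanced_values_def by blast
    define w :: "real ^ ('n set)" where "w = (\<chi> S. if S \<in> B then l S else 0)"
    have "w \<in> K B" using l by (auto simp: K_def w_def balancing_weights_def)
    moreover have "y = g B w" unfolding y g_def w_def by simp
    ultimately show "y \<in> (\<Union>B\<in>Pow (A - {{}}). g B ` K B)" using B by blast
  next
    fix y assume "y \<in> (\<Union>B\<in>Pow (A - {{}}). g B ` K B)"
    then obtain B w where "B \<subseteq> A - {{}}" "w \<in> K B" "y = g B w" by blast
    then show "y \<in> balanced_values A v u"
      unfolding balanced_values_def balancing_weights_def K_def g_def
      by (intro CollectI exI[of _ B] exI[of _ "\<lambda>S. w $ S"]) auto
  qed
  have "compact (K B)" if "B \<subseteq> A - {{}}" for B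
  proof -
    have le: "w $ S \<le> 1" if w: "w \<in> K B" for w S
    proof (cases "S \<in> B")
      case True
      then obtain i where i: "i \<in> S" using \<open>B \<subseteq> A - {{}}\<close> by blast
      have "w $ S \<le> (\<Sum>T\<in>B. w $ T * indicator T i)"
        using True w i member_le_sum[of S B "\<lambda>T. w $ T * indicator T i"]
        by (auto simp: K_def)
      also have "\<dots> = (\<Sum>T\<in>B. w $ T *\<^sub>R char_vec T) $ i" by (simp add: char_vec_def)
      also have "\<dots> = 1" using w by (simp add: K_def char_vec_def)
      finally show ?thesis .
    qed (use w in \<open>auto simp: K_def\<close>)
    have sub: "K B \<subseteq> cbox 0 1" using le by (auto simp: mem_box_cart K_def)
    have "closed (K B)"
    proof -
      have "K B = (\<Inter>S. {w. 0 \<le> w $ S}) \<inter> (\<Inter>S\<in>-B. {w. w $ S = 0})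
          \<inter> {w. (\<Sum>S\<in>B. w $ S *\<^sub>R char_vec S) = char_vec UNIV}"
        by (auto simp: K_def)
      then show ?thesis
        by (auto intro!: closed_Int closed_INT closed_Collect_le closed_Collect_eq continuous_intros)
    qed
    then show ?thesis using sub compact_Int_closed[OF compact_cbox, of "K B" 0 1]
      by (simp add: Int_absorb1)
  qed
  moreover have "continuous_on (K B) (g B)" for B
    unfolding g_def by (cases "UNIV \<in> B") (auto intro!: continuous_intros)
  ultimately have "compact (balanced_values A v u)"
    unfolding eq by (intro compact_UN) (auto intro!: compact_continuous_image)
  moreover have "balanced_values A v u \<noteq> {}"
  proof -
    have "v UNIV \<in> balanced_values A v u"
      unfolding balanced_values_def using assms
      by (intro CollectI exI[of _ "{UNIV}"] exI[of _ "\<lambda>_. 1"]) (auto simp: balancing_weights_def)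
    then show ?thesis by blast
  qed
  ultimately obtain m where m: "m \<in> balanced_values A v u"
      "\<And>y. y \<in> balanced_values A v u \<Longrightarrow> y \<le> m"
    using compact_attains_sup by metis
  then have "Sup (balanced_values A v u) = m" by (intro cSup_eq_maximum)
  with m show "Sup (balanced_values A v u) \<in> balanced_values A v u"
    and "\<forall>y \<in> balanced_values A v u. y \<le> Sup (balanced_values A v u)" by auto
qed

definition proper_partitions :: "'n set set \<Rightarrow> 'n set \<Rightarrow> 'n set set set" where
  "proper_partitions A S = {P. partition_on S P \<and> P \<subseteq> proper A \<and> P \<noteq> {S}}"

definition u_essential ::
  "'n::finite set set \<Rightarrow> ('n set \<Rightarrow> real) \<Rightarrow> ('n set \<Rightarrow> real \<Rightarrow> real) \<Rightarrow> 'n set set" where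
  "u_essential A v u =
     {S \<in> proper A. proper_partitions A S = {} \<or>
        (\<exists>x\<in>u_core A v u. u S (excess v S x) >
           Max ((\<lambda>P. \<Sum>T\<in>P. u T (excess v T x)) ` proper_partitions A S))}"

definition is_minimum :: "real \<Rightarrow> real set \<Rightarrow> bool" where
  "is_minimum t F \<longleftrightarrow> t \<in> F \<and> (\<forall>s\<in>F. t \<le> s)"

definition sublevel :: "('n::finite set \<Rightarrow> real) \<Rightarrow> ('n set \<Rightarrow> real \<Rightarrow> real) \<Rightarrow>
    (real ^ 'n) set \<Rightarrow> 'n set set \<Rightarrow> real \<Rightarrow> (real ^ 'n) set" where
  "sublevel v u Z C t = {x \<in> Z. \<forall>S\<in>C. u S (excess v S x) \<le> t}"

definition feasible_levels :: "('n::finite set \<Rightarrow> real) \<Rightarrow> ('n set \<Rightarrow> real \<Rightarrow> real) \<Rightarrow>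
    (real ^ 'n) set \<Rightarrow> 'n set set \<Rightarrow> real set" where
  "feasible_levels v u Z C = {t. \<exists>x\<in>Z. \<forall>S\<in>C. u S (excess v S x) \<le> t}"

definition fixed_coalitions :: "'n::finite set set \<Rightarrow> ('n set \<Rightarrow> real) \<Rightarrow>
    ('n set \<Rightarrow> real \<Rightarrow> real) \<Rightarrow> (real ^ 'n) set \<Rightarrow> 'n set set" where
  "fixed_coalitions A v u Z = {S \<in> proper A. \<exists>c. \<forall>x\<in>Z. u S (excess v S x) = c}"

definition settled :: "(nat \<Rightarrow> 'n set set) \<Rightarrow> nat \<Rightarrow> 'n set set" where
  "settled W k = (\<Union>r\<in>{1..k - 1}. W r)"

text \<open>
  \<open>scheme A v u t X W K\<close>: the scheme is defined up to step \<open>K\<close> and produces \<open>t k\<close>, \<open>X k\<close>, \<open>W k\<close> for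
  \<open>1 \<le> k \<le> K\<close>.  Once every coalition is settled, \<open>t k\<close> is arbitrary and \<open>X k = X (k - 1)\<close>.
\<close>

definition scheme :: "'n::finite set set \<Rightarrow> ('n set \<Rightarrow> real) \<Rightarrow> ('n set \<Rightarrow> real \<Rightarrow> real) \<Rightarrow>
    (nat \<Rightarrow> real) \<Rightarrow> (nat \<Rightarrow> (real ^ 'n) set) \<Rightarrow> (nat \<Rightarrow> 'n set set) \<Rightarrow> nat \<Rightarrow> bool" where
  "scheme A v u t X W K \<longleftrightarrow>
     (1 \<le> K \<longrightarrow>
        is_minimum (t 1) (utility_range A u \<inter> feasible_levels v u (preimputations v) (proper A)) \<and>
        X 1 = sublevel v u (preimputations v) (proper A) (t 1)) \<and>
     (\<forall>k\<in>{2..K}.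
        (proper A - settled W k \<noteq> {} \<longrightarrow>
           is_minimum (t k) (feasible_levels v u (X (k - 1)) (proper A - settled W k))) \<and>
        X k = sublevel v u (X (k - 1)) (proper A - settled W k) (t k)) \<and>
     (\<forall>k\<in>{1..K}. W k = fixed_coalitions A v u (X k))"

definition essential_set :: "'n::finite set set \<Rightarrow> ('n set \<Rightarrow> real) \<Rightarrow> ('n set \<Rightarrow> real \<Rightarrow> real) \<Rightarrow>
    (nat \<Rightarrow> real) \<Rightarrow> (nat \<Rightarrow> (real ^ 'n) set) \<Rightarrow> (nat \<Rightarrow> 'n set set) \<Rightarrow> nat \<Rightarrow> (real ^ 'n) set" where
  "essential_set A v u t X W k =
     (if k = 1 then sublevel v u (preimputations v) (u_essential A v u) (t 1)
      else sublevel v u (X (k - 1)) (u_essential A v u - settled W k) (t k))"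

end

theory Submission
  imports Defs
begin

text \<open>
  An inessential coalition never matters because it is dominated by a partition: at every point of
  the \<open>u\<close>-core its transformed excess is at most the sum of the transformed excesses of the members
  of some partition into smaller feasible coalitions.  All summands are nonpositive on the core, so
  the inessential coalition is dominated by each single member of that partition.  Descending to
  smaller and smaller coalitions, any violation of a constraint leads to the violation of a
  constraint of an essential coalition.

  For this the points considered have to lie in the core.  From step 2 on this is so, because
  \<open>X (k - 1) \<subseteq> X 1\<close> and \<open>X 1\<close> is contained in the core as soon as \<open>t 1 \<le> 0\<close>.  The
  latter is what \<open>u\<close>-balancedness provides: either the common range of the functions \<open>u S\<close>, to which
  \<open>t 1\<close> belongs, is negative, or the core is nonempty by the Bondareva--Shapley argument
  (\<open>u_core_nonempty\<close>, from Farkas' lemma in the form \<open>farkas_one_equation\<close>), so that 0 is a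
  feasible level.  The descent must not end in a
  dominating partition that consists of settled coalitions only.  This is excluded because then the
  payoff of each member is constant on \<open>X (k - 1)\<close>, hence so is the payoff of their union, which
  is therefore settled as well (\<open>settled_if_partitioned\<close>).

  In step 1 a point \<open>x\<close> satisfying the essential constraints is not known to lie in the core.  Since
  \<open>t 1\<close> is in the common range of the strictly increasing functions \<open>u S\<close>, each constraint is an
  affine inequality in \<open>x\<close>.  So one can start in a point of \<open>X 1\<close>, move towards \<open>x\<close>, and
  stop at the last point \<open>z\<close> that still satisfies all constraints (\<open>last_point_of_segment\<close>).  If
  \<open>z \<noteq> x\<close>, some coalition is tight at \<open>z\<close> and gets strictly worse towards \<open>x\<close>; the descent is then
  carried out at \<open>z\<close>, which is in the core, for this property of coalitions
  (\<open>essential_constraints_suffice\<close>).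
\<close>

section \<open>Farkas' lemma and nonemptiness of the core\<close>

text \<open>
  The hypothesis on the multipliers keeps \<open>(0, 1)\<close> out of the cone generated by the vectors
  \<open>(a i, b i)\<close> and \<open>\<plusminus> (c, d)\<close>.  This cone is closed, being finitely generated, so a hyperplane
  separates the two; its normal, scaled to have last component \<open>-1\<close>, yields a solution.
\<close>

lemma farkas_one_equation:
  fixes a :: "'i \<Rightarrow> 'a::euclidean_space" and b :: "'i \<Rightarrow> real"
  assumes fin: "finite I"
    and cert: "\<And>l m. \<forall>i\<in>I. 0 \<le> l i \<Longrightarrow> (\<Sum>i\<in>I. l i *\<^sub>R a i) = m *\<^sub>R c \<Longrightarrow> (\<Sum>i\<in>I. l i * b i) \<le> m * d"
  shows "\<exists>x. x \<bullet> c = d \<and> (\<forall>i\<in>I. b i \<le> x \<bullet> a i)"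
proof -
  define G where "G = (\<lambda>i. (a i, b i)) ` I \<union> {(c, d), - (c, d)}"
  define C where "C = convex_cone hull G"
  define D where "D = {(\<Sum>i\<in>I. l i *\<^sub>R (a i, b i)) - m *\<^sub>R (c, d) | l m. \<forall>i\<in>I. 0 \<le> l i}"
  have "convex_cone D"
    unfolding convex_cone_iff
  proof (intro conjI ballI allI impI)
    show "0 \<in> D"
      unfolding D_def by (intro CollectI exI[of _ "\<lambda>_. 0"] exI[of _ 0]) (simp flip: zero_prod_def)
  next
    fix p q assume "p \<in> D" "q \<in> D"
    then obtain l m l' m' where *: "\<forall>i\<in>I. 0 \<le> l i" "\<forall>i\<in>I. 0 \<le> l' i"
      "p = (\<Sum>i\<in>I. l i *\<^sub>R (a i, b i)) - m *\<^sub>R (c, d)"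
      "q = (\<Sum>i\<in>I. l' i *\<^sub>R (a i, b i)) - m' *\<^sub>R (c, d)"
      unfolding D_def by blast
    have "p + q = (\<Sum>i\<in>I. (l i + l' i) *\<^sub>R (a i, b i)) - (m + m') *\<^sub>R (c, d)"
      unfolding * scaleR_left_distrib sum.distrib by simp
    moreover have "\<forall>i\<in>I. 0 \<le> l i + l' i" using * by simp
    ultimately show "p + q \<in> D"
      unfolding D_def by (intro CollectI exI[of _ "\<lambda>i. l i + l' i"] exI[of _ "m + m'"]) simp
  next
    fix p and r :: real assume "p \<in> D" "0 \<le> r"
    then obtain l m where *: "\<forall>i\<in>I. 0 \<le> l i"
      "p = (\<Sum>i\<in>I. l i *\<^sub>R (a i, b i)) - m *\<^sub>R (c, d)"
      unfolding D_def by blast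
    have "r *\<^sub>R p = (\<Sum>i\<in>I. (r * l i) *\<^sub>R (a i, b i)) - (r * m) *\<^sub>R (c, d)"
      unfolding * scaleR_diff_right scaleR_sum_right scaleR_scaleR ..
    moreover have "\<forall>i\<in>I. 0 \<le> r * l i" using * \<open>0 \<le> r\<close> by simp
    ultimately show "r *\<^sub>R p \<in> D"
      unfolding D_def by (intro CollectI exI[of _ "\<lambda>i. r * l i"] exI[of _ "r * m"]) simp
  qed
  moreover have "G \<subseteq> D"
  proof
    fix g assume "g \<in> G"
    then consider (gen) j where "j \<in> I" "g = (a j, b j)" | (pos) "g = (c, d)" | (neg) "g = - (c, d)"
      unfolding G_def by blast
    then show "g \<in> D"
    proof cases
      case gen
      have "(\<Sum>i\<in>I. (if i = j then 1 else 0) *\<^sub>R (a i, b i))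
          = (\<Sum>i\<in>I. if i = j then (a i, b i) else 0)"
        by (intro sum.cong) (auto simp: zero_prod_def)
      then show ?thesis
        unfolding D_def using gen fin
        by (intro CollectI exI[of _ "\<lambda>i. if i = j then 1 else 0"] exI[of _ 0]) simp
    next
      case pos
      then show ?thesis
        unfolding D_def by (intro CollectI exI[of _ "\<lambda>_. 0"] exI[of _ "-1"]) (simp flip: zero_prod_def)
    next
      case neg
      then show ?thesis
        unfolding D_def by (intro CollectI exI[of _ "\<lambda>_. 0"] exI[of _ 1]) (simp flip: zero_prod_def)
    qed
  qed
  ultimately have "C \<subseteq> D"
    unfolding C_def by (simp add: hull_minimal)
  have "(0, 1) \<notin> D"
  proof
    assume "(0, 1) \<in> D"
    then obtain l m where *: "\<forall>i\<in>I. 0 \<le> l i"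
      "(0, 1) = (\<Sum>i\<in>I. l i *\<^sub>R (a i, b i)) - m *\<^sub>R (c, d)"
      unfolding D_def by blast
    from arg_cong[OF *(2), of fst] have "(\<Sum>i\<in>I. l i *\<^sub>R a i) = m *\<^sub>R c"
      by (simp add: fst_sum)
    moreover from arg_cong[OF *(2), of snd] have "(\<Sum>i\<in>I. l i * b i) = m * d + 1"
      by (simp add: snd_sum)
    ultimately show False using cert[of l m] * by simp
  qed
  then have "(0, 1) \<notin> C" using \<open>C \<subseteq> D\<close> by blast
  have "closed C"
    unfolding C_def G_def using fin by (intro closed_convex_cone_hull) simp
  have "convex C" unfolding C_def by (rule convex_convex_cone_hull)
  obtain n \<beta> where sep: "n \<bullet> (0, 1) < \<beta>" "\<And>z. z \<in> C \<Longrightarrow> \<beta> < n \<bullet> z"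
    using separating_hyperplane_closed_point[OF \<open>convex C\<close> \<open>closed C\<close> \<open>(0, 1) \<notin> C\<close>] by blast
  obtain p q where n: "n = (p, q)" by (cases n)
  have "\<beta> < 0"
    using sep(2)[of 0] by (simp add: C_def convex_cone_hull_contains_0)
  then have "q < 0" using sep(1) n by simp
  have nonneg: "0 \<le> n \<bullet> g" if "g \<in> G" for g
  proof (rule ccontr)
    assume neg: "\<not> 0 \<le> n \<bullet> g"
    \<comment> \<open>the multiple of \<open>g\<close> that lies on the separating hyperplane\<close>
    have "(\<beta> / (n \<bullet> g)) *\<^sub>R g \<in> C"
      unfolding C_def using that neg \<open>\<beta> < 0\<close>
      by (intro convex_cone_hull_mul hull_inc) (simp_all add: divide_nonpos_neg)
    from sep(2)[OF this] neg show False by simp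
  qed
  define x where "x = (1 / - q) *\<^sub>R p"
  have p: "p = (- q) *\<^sub>R x" using \<open>q < 0\<close> by (simp add: x_def)
  have le: "s \<le> x \<bullet> r" if "(r, s) \<in> G" for r s
  proof -
    have "0 \<le> (- q) * (x \<bullet> r - s)"
      using nonneg[OF that] by (simp add: n p algebra_simps)
    then show ?thesis using \<open>q < 0\<close> unfolding zero_le_mult_iff by auto
  qed
  have "x \<bullet> c = d" using le[of c d] le[of "- c" "- d"] by (simp add: G_def)
  moreover have "b i \<le> x \<bullet> a i" if "i \<in> I" for i
    using le[of "a i" "b i"] that by (simp add: G_def)
  ultimately show ?thesis by blast
qed

lemma inner_char_vec: "x \<bullet> char_vec S = payoff x S"
proof -
  have "x \<bullet> char_vec S = (\<Sum>i\<in>UNIV. if i \<in> S then x $ i else 0)"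
    unfolding inner_vec_def char_vec_def by (intro sum.cong) (auto simp: indicator_def)
  then show ?thesis by (simp add: payoff_def sum.If_cases)
qed

lemma utility_le_iff:
  assumes "utility A u" "S \<in> proper A"
  shows "u S r \<le> u S s \<longleftrightarrow> r \<le> s"
proof (rule strict_mono_less_eq)
  show "strict_mono (u S)" using assms unfolding utility_def by blast
qed

lemma utility_eq_iff:
  assumes "utility A u" "S \<in> proper A"
  shows "u S r = u S s \<longleftrightarrow> r = s"
proof
  assume "u S r = u S s"
  then have "u S r \<le> u S s" "u S s \<le> u S r" by simp_all
  then show "r = s" unfolding utility_le_iff[OF assms] by (rule antisym)
qed simp

lemma utility_inv:
  assumes "utility A u" "S \<in> proper A" "r \<in> utility_range A u"
  shows "u S (inv (u S) r) = r"
proof (rule f_inv_into_f)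
  show "r \<in> range (u S)" using assms unfolding utility_def utility_range_def by blast
qed

text \<open>
  The Bondareva--Shapley argument for the game whose worths are shifted by \<open>inv (u S) 0\<close>.  Multipliers
  as in Farkas' lemma combine the characteristic vectors to \<open>m\<close> times that of the grand coalition.
  If \<open>m = 0\<close>, they all vanish because coalitions are nonempty; otherwise their quotients by \<open>m\<close> are
  balancing weights.
\<close>

lemma u_core_nonempty:
  fixes A :: "'n::finite set set"
  assumes "feasible_family A" "utility A u" "0 \<in> utility_range A u"
    and bal: "Sup (balanced_values A v u) \<le> v UNIV"
  shows "u_core A v u \<noteq> {}"
proof -
  define w where "w S = v S - inv (u S) 0" for S
  have "\<exists>x. x \<bullet> char_vec UNIV = v UNIV \<and> (\<forall>S\<in>proper A. w S \<le> x \<bullet> char_vec S)"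
  proof (rule farkas_one_equation)
    fix l m
    assume l: "\<forall>S\<in>proper A. 0 \<le> l S"
      and eq: "(\<Sum>S\<in>proper A. l S *\<^sub>R char_vec S) = m *\<^sub>R (char_vec UNIV :: real ^ 'n)"
    have m: "(\<Sum>S\<in>proper A. l S * indicator S i) = m" for i
      using arg_cong[OF eq, of "\<lambda>z. z $ i"] by (simp add: char_vec_def)
    have "0 \<le> (\<Sum>S\<in>proper A. l S * indicator S undefined)"
      using l by (intro sum_nonneg mult_nonneg_nonneg) auto
    then have "0 \<le> m" using m by simp
    show "(\<Sum>S\<in>proper A. l S * w S) \<le> m * v UNIV"
    proof (cases "m = 0")
      case True
      have "l S = 0" if S: "S \<in> proper A" for S
      proof -
        obtain i where "i \<in> S" using S unfolding proper_def by blast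
        have "l S * indicator S i \<le> (\<Sum>S\<in>proper A. l S * indicator S i)"
          using S l by (intro member_le_sum) auto
        then have "l S \<le> 0" using m[of i] True \<open>i \<in> S\<close> by simp
        with l S show ?thesis by force
      qed
      then show ?thesis using True by simp
    next
      case False
      have "balancing_weights (proper A) (\<lambda>S. l S / m)"
        unfolding balancing_weights_def
      proof
        show "\<forall>S\<in>proper A. 0 \<le> l S / m" using l \<open>0 \<le> m\<close> by simp
        have "(\<Sum>S\<in>proper A. (l S / m) *\<^sub>R char_vec S)
            = (1 / m) *\<^sub>R (\<Sum>S\<in>proper A. l S *\<^sub>R (char_vec S :: real ^ 'n))"
          by (simp add: scaleR_sum_right)
        then show "(\<Sum>S\<in>proper A. (l S / m) *\<^sub>R char_vec S) = (char_vec UNIV :: real ^ 'n)"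
          using False eq by simp
      qed
      moreover have "proper A \<subseteq> A - {{}}" "UNIV \<notin> proper A" by (auto simp: proper_def)
      ultimately have "(\<Sum>S\<in>proper A. l S / m * w S) \<in> balanced_values A v u"
        unfolding balanced_values_def w_def
        by (intro CollectI exI[of _ "proper A"] exI[of _ "\<lambda>S. l S / m"]) simp
      then have "(\<Sum>S\<in>proper A. l S / m * w S) \<le> v UNIV"
        using Sup_balanced_values(2)[of A v u] assms(1) bal
        unfolding feasible_family_def by fastforce
      then have "m * (\<Sum>S\<in>proper A. l S / m * w S) \<le> m * v UNIV"
        using \<open>0 \<le> m\<close> by (rule mult_left_mono)
      then show ?thesis using False by (simp add: sum_distrib_left)
    qed
  qed simp
  then obtain x where x: "payoff x UNIV = v UNIV" "\<And>S. S \<in> proper A \<Longrightarrow> w S \<le> payoff x S"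
    by (auto simp: inner_char_vec)
  have "u S (excess v S x) \<le> 0" if "S \<in> proper A" for S
    using x(2)[OF that] utility_le_iff[OF assms(2) that, of "excess v S x" "inv (u S) 0"]
      utility_inv[OF assms(2) that assms(3)]
    by (simp add: w_def excess_def)
  with x(1) show ?thesis unfolding u_core_def by blast
qed

text \<open>
  If the range lies below 0, every level is negative; otherwise a core point attains level 0.
\<close>

lemma first_level_nonpos:
  assumes "feasible_family A" "utility A u" "u_balanced A v u"
    and min: "is_minimum t
      (utility_range A u \<inter> feasible_levels v u (preimputations v) (proper A))"
  shows "t \<le> 0"
proof (cases "utility_range A u \<subseteq> {..<0}")
  case True
  then show ?thesis using min unfolding is_minimum_def by auto
next
  case False
  then have zero: "0 \<in> utility_range A u" and "Sup (balanced_values A v u) \<le> v UNIV"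
    using assms(3) unfolding u_balanced_def by auto
  then obtain x where "x \<in> u_core A v u" using u_core_nonempty[OF assms(1,2)] by blast
  then have "0 \<in> feasible_levels v u (preimputations v) (proper A)"
    unfolding feasible_levels_def u_core_def preimputations_def by blast
  with zero min show ?thesis unfolding is_minimum_def by blast
qed

section \<open>Inessential coalitions\<close>

lemma proper_partition_part:
  assumes P: "P \<in> proper_partitions A S" and "T \<in> P"
  shows "T \<in> proper A" "T \<subset> S"
proof -
  have part: "partition_on S P" and "P \<noteq> {S}" and "P \<subseteq> proper A"
    using P by (auto simp: proper_partitions_def)
  show "T \<in> proper A" using \<open>T \<in> P\<close> \<open>P \<subseteq> proper A\<close> by blast
  have "T \<noteq> S"
  proof
    assume "T = S"
    have "Q = S" if "Q \<in> P" for Q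
    proof (rule ccontr)
      assume "Q \<noteq> S"
      then have "Q \<inter> S = {}"
        using disjointD[OF partition_onD2[OF part]] that \<open>T \<in> P\<close> \<open>T = S\<close> by blast
      moreover have "Q \<subseteq> S" using partition_onD1[OF part] that by blast
      ultimately have "Q = {}" by blast
      then show False using partition_onD3[OF part] that by blast
    qed
    with \<open>T \<in> P\<close> \<open>T = S\<close> \<open>P \<noteq> {S}\<close> show False by blast
  qed
  moreover have "T \<subseteq> S" using \<open>T \<in> P\<close> partition_onD1[OF part] by blast
  ultimately show "T \<subset> S" by blast
qed

lemma payoff_partition:
  assumes "P \<in> proper_partitions A S"
  shows "payoff x S = (\<Sum>T\<in>P. payoff x T)"
  unfolding payoff_def
proof (rule sum.partition)
  show "partition_on S P" using assms unfolding proper_partitions_def by blast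
qed simp

text \<open>
  On the core every summand is nonpositive, so a bound by the sum over the partition is at the same
  time a bound by each of its members.
\<close>

lemma inessential_dominated:
  fixes A :: "'n::finite set set"
  assumes "S \<in> proper A" "S \<notin> u_essential A v u" "z \<in> u_core A v u"
  obtains P where "P \<in> proper_partitions A S"
    and "\<And>T. T \<in> P \<Longrightarrow> u S (excess v S z) \<le> u T (excess v T z)"
proof -
  define f where "f P = (\<Sum>T\<in>P. u T (excess v T z))" for P
  have "proper_partitions A S \<noteq> {}" and "u S (excess v S z) \<le> Max (f ` proper_partitions A S)"
    using assms unfolding u_essential_def f_def by force+
  moreover have "Max (f ` proper_partitions A S) \<in> f ` proper_partitions A S"
    using calculation(1) by (intro Max_in) auto
  ultimately obtain P where P: "P \<in> proper_partitions A S" "u S (excess v S z) \<le> f P"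
    by (elim imageE) simp
  have "u S (excess v S z) \<le> u T (excess v T z)" if "T \<in> P" for T
  proof -
    have "f P = u T (excess v T z) + (\<Sum>T\<in>P - {T}. u T (excess v T z))"
      unfolding f_def using that by (intro sum.remove) auto
    moreover have "(\<Sum>T\<in>P - {T}. u T (excess v T z)) \<le> 0"
      using proper_partition_part(1)[OF P(1)] assms(3)
      by (intro sum_nonpos) (auto simp: u_core_def)
    ultimately show ?thesis using P(2) by simp
  qed
  with P(1) show ?thesis by (rule that)
qed

section \<open>The first step\<close>

text \<open>
  The parameter of the last point is the least ratio at which one of the inequalities violated at
  \<open>x\<close> becomes tight, as in the ratio test of the simplex method.
\<close>

lemma last_point_of_segment:
  fixes e :: "'s \<Rightarrow> 'a::real_vector \<Rightarrow> real"
  assumes "finite C" "S \<in> C" "d S < e S x"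
    and y: "\<And>S. S \<in> C \<Longrightarrow> e S y \<le> d S"
    and affine: "\<And>S r. S \<in> C \<Longrightarrow> e S (y + r *\<^sub>R (x - y)) = e S y + r * (e S x - e S y)"
  obtains r T where "\<And>S. S \<in> C \<Longrightarrow> e S (y + r *\<^sub>R (x - y)) \<le> d S"
    and "T \<in> C" "e T (y + r *\<^sub>R (x - y)) = d T" "d T < e T x"
proof -
  define V where "V = {S \<in> C. d S < e S x}"
  define ratio where "ratio S = (d S - e S y) / (e S x - e S y)" for S
  have V: "finite V" "V \<noteq> {}" using assms(1-3) by (auto simp: V_def)
  define T where "T = arg_min_on ratio V"
  have T: "T \<in> V" "\<And>S. S \<in> V \<Longrightarrow> ratio T \<le> ratio S"
    unfolding T_def using V by (auto intro: arg_min_if_finite arg_min_least)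
  have gap: "0 < e S x - e S y" if "S \<in> V" for S
    using that y[of S] by (auto simp: V_def)
  have "0 \<le> ratio T" "ratio T \<le> 1"
    using gap[OF T(1)] T(1) y[of T] by (auto simp: ratio_def V_def divide_simps)
  have "e S (y + ratio T *\<^sub>R (x - y)) \<le> d S" if "S \<in> C" for S
  proof (cases "S \<in> V")
    case True
    have "ratio T * (e S x - e S y) \<le> ratio S * (e S x - e S y)"
      using T(2)[OF True] gap[OF True] by (intro mult_right_mono) auto
    also have "\<dots> = d S - e S y" using gap[OF True] by (simp add: ratio_def)
    finally show ?thesis using affine[OF that] by simp
  next
    case False
    then have "e S x \<le> d S" using that by (auto simp: V_def)
    then have "(1 - ratio T) * e S y + ratio T * e S x \<le> (1 - ratio T) * d S + ratio T * d S"
      using y[OF that] \<open>0 \<le> ratio T\<close> \<open>ratio T \<le> 1\<close> by (intro add_mono mult_left_mono) auto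
    then have "e S y + ratio T * (e S x - e S y) \<le> d S" by (simp add: algebra_simps)
    then show ?thesis using affine[OF that] by simp
  qed
  moreover have "e T (y + ratio T *\<^sub>R (x - y)) = d T"
    using gap[OF T(1)] affine[of T] T(1) by (simp add: ratio_def V_def)
  ultimately show ?thesis using that[of "ratio T" T] T(1) by (auto simp: V_def)
qed

lemma payoff_segment:
  "payoff (y + r *\<^sub>R (x - y)) S = payoff y S + r * (payoff x S - payoff y S)"
  unfolding inner_char_vec[symmetric] by (simp add: inner_simps)

text \<open>
  At the last point \<open>z\<close> of the segment from \<open>y\<close> to \<open>x\<close> call a coalition critical if its constraint is
  tight at \<open>z\<close> and violated at \<open>x\<close>.  A critical coalition is inessential, and each member of a
  partition dominating it is tight at \<open>z\<close> too.  Its payoff, the sum of the members' payoffs, falls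
  from \<open>z\<close> to \<open>x\<close>, so the payoff of some member falls; this member is critical and smaller.
\<close>

lemma essential_constraints_suffice:
  fixes A :: "'n::finite set set"
  assumes util: "utility A u" and range: "t \<in> utility_range A u" and "t \<le> 0"
    and y: "y \<in> sublevel v u (preimputations v) (proper A) t"
    and x: "x \<in> sublevel v u (preimputations v) (u_essential A v u) t"
  shows "x \<in> sublevel v u (preimputations v) (proper A) t"
proof (rule ccontr)
  assume "x \<notin> sublevel v u (preimputations v) (proper A) t"
  define d where "d S = inv (u S) t" for S
  have level: "u S r \<le> t \<longleftrightarrow> r \<le> d S" "u S (d S) = t" if "S \<in> proper A" for S r
    using utility_le_iff[OF util that, of r "d S"] utility_inv[OF util that range]
    by (auto simp: d_def)
  obtain S0 where "S0 \<in> proper A" "d S0 < excess v S0 x"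
    using x \<open>x \<notin> _\<close> level by (force simp: sublevel_def)
  moreover have "excess v S y \<le> d S" if "S \<in> proper A" for S
    using y that level by (auto simp: sublevel_def)
  moreover have "excess v S (y + r *\<^sub>R (x - y))
      = excess v S y + r * (excess v S x - excess v S y)" for S r
    unfolding excess_def payoff_segment by (simp add: algebra_simps)
  ultimately obtain r S1
    where feas: "\<And>S. S \<in> proper A \<Longrightarrow> excess v S (y + r *\<^sub>R (x - y)) \<le> d S"
      and S1: "S1 \<in> proper A" "excess v S1 (y + r *\<^sub>R (x - y)) = d S1" "d S1 < excess v S1 x"
    using last_point_of_segment[of "proper A" S0 d "excess v" x y] finite by metis
  define z where "z = y + r *\<^sub>R (x - y)"
  have "payoff z UNIV = v UNIV"
    using x y by (simp add: z_def payoff_segment sublevel_def preimputations_def)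
  then have core: "z \<in> u_core A v u"
    unfolding u_core_def using feas level(1) \<open>t \<le> 0\<close> by (force simp: z_def)
  define critical where
    "critical S \<longleftrightarrow> S \<in> proper A \<and> excess v S z = d S \<and> d S < excess v S x" for S
  have "\<not> critical S" for S
  proof (induction S rule: measure_induct_rule[of card])
    case (less S)
    show ?case
    proof
      assume S: "critical S"
      then have "S \<notin> u_essential A v u"
        using x level(1)[of S] by (auto simp: critical_def sublevel_def)
      then obtain P where P: "P \<in> proper_partitions A S"
        and dom: "\<And>T. T \<in> P \<Longrightarrow> u S (excess v S z) \<le> u T (excess v T z)"
        using inessential_dominated[of S A v u z] S core unfolding critical_def by blast
      have tight: "excess v T z = d T" if "T \<in> P" for T
      proof -
        have T: "T \<in> proper A" using proper_partition_part[OF P that] by blast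
        have "u T (d T) \<le> u T (excess v T z)"
          using dom[OF that] S level(2)[of S] level(2)[OF T] by (simp add: critical_def)
        then show ?thesis
          using utility_le_iff[OF util T] feas[OF T] by (simp add: z_def)
      qed
      have "payoff x S < payoff z S" using S by (simp add: critical_def excess_def)
      then have "\<not> (\<forall>T\<in>P. payoff z T \<le> payoff x T)"
        unfolding payoff_partition[OF P] by (meson not_le sum_mono)
      then obtain T where T: "T \<in> P" "payoff x T < payoff z T" by force
      have "critical T"
        using tight[OF T(1)] T proper_partition_part[OF P T(1)]
        by (simp add: critical_def excess_def)
      moreover have "card T < card S"
        using proper_partition_part[OF P T(1)] by (simp add: psubset_card_mono)
      ultimately show False using less by blast
    qed
  qed
  with S1 show False by (auto simp: critical_def z_def)
qed

section \<open>The later steps\<close>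

lemma payoff_constant_if_fixed:
  assumes "utility A u" "S \<in> fixed_coalitions A v u Z" "x \<in> Z" "y \<in> Z"
  shows "payoff x S = payoff y S"
proof -
  have S: "S \<in> proper A" "u S (excess v S x) = u S (excess v S y)"
    using assms(2-4) by (auto simp: fixed_coalitions_def)
  then have "excess v S x = excess v S y" using utility_eq_iff[OF assms(1)] by blast
  then show ?thesis by (simp add: excess_def)
qed

lemma fixed_if_payoff_constant:
  assumes "S \<in> proper A" "\<And>x y. x \<in> Z \<Longrightarrow> y \<in> Z \<Longrightarrow> payoff x S = payoff y S"
  shows "S \<in> fixed_coalitions A v u Z"
proof (cases "Z = {}")
  case False
  then obtain y where "y \<in> Z" by blast
  have "u S (excess v S x) = u S (excess v S y)" if "x \<in> Z" for x
    unfolding excess_def assms(2)[OF that \<open>y \<in> Z\<close>] ..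
  with assms(1) show ?thesis unfolding fixed_coalitions_def by blast
qed (use assms(1) in \<open>simp add: fixed_coalitions_def\<close>)

text \<open>
  Here \<open>F\<close> stands for the settled coalitions.  By \<open>union\<close>, a dominating partition of a coalition
  outside \<open>F\<close> has a member outside \<open>F\<close>; this member is smaller, and its bound is inherited.
\<close>

lemma essential_constraints_suffice_in_core:
  fixes A :: "'n::finite set set"
  assumes "x \<in> u_core A v u"
    and ess: "\<forall>S\<in>u_essential A v u - F. u S (excess v S x) \<le> t"
    and union: "\<And>S P. S \<in> proper A \<Longrightarrow> P \<in> proper_partitions A S \<Longrightarrow> P \<subseteq> F \<Longrightarrow> S \<in> F"
  shows "S \<in> proper A - F \<Longrightarrow> u S (excess v S x) \<le> t"
proof (induction S rule: measure_induct_rule[of card])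
  case (less S)
  show ?case
  proof (cases "S \<in> u_essential A v u")
    case True
    then show ?thesis using ess less.prems by blast
  next
    case False
    then obtain P where P: "P \<in> proper_partitions A S"
      and dom: "\<And>T. T \<in> P \<Longrightarrow> u S (excess v S x) \<le> u T (excess v T x)"
      using inessential_dominated[OF _ False assms(1)] less.prems by blast
    then obtain T where T: "T \<in> P" "T \<notin> F" using union less.prems by blast
    have "card T < card S" "T \<in> proper A - F"
      using proper_partition_part[OF P T(1)] T by (simp_all add: psubset_card_mono)
    then have "u T (excess v T x) \<le> t" by (rule less.IH)
    with dom[OF T(1)] show ?thesis by linarith
  qed
qed

lemma scheme_antimono:
  assumes "scheme A v u t X W k" "1 \<le> r" "r \<le> s" "s \<le> k"
  shows "X s \<subseteq> X r"
  using assms(3,4)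
proof (induction s rule: dec_induct)
  case (step n)
  then have "X (Suc n) = sublevel v u (X n) (proper A - settled W (Suc n)) (t (Suc n))"
    using assms(1,2) unfolding scheme_def by (auto dest!: bspec[of _ _ "Suc n"])
  then have "X (Suc n) \<subseteq> X n" by (auto simp: sublevel_def)
  moreover have "X n \<subseteq> X r" using step by simp
  ultimately show ?case by blast
qed simp

text \<open>
  Constancy on an early \<open>X r\<close> is inherited by \<open>X (k - 1)\<close>, and constancy on \<open>X (k - 1)\<close> is what
  membership in \<open>W (k - 1)\<close> means.  Hence the settled coalitions are closed under disjoint unions.
\<close>

lemma settled_if_partitioned:
  fixes A :: "'n::finite set set"
  assumes "utility A u" "scheme A v u t X W k" "2 \<le> k"
    and S: "S \<in> proper A" and P: "P \<in> proper_partitions A S" "P \<subseteq> settled W k"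
  shows "S \<in> settled W k"
proof -
  have W: "W r = fixed_coalitions A v u (X r)" if "1 \<le> r" "r \<le> k" for r
    using assms(2) that unfolding scheme_def by auto
  have "payoff x T = payoff y T" if xy: "x \<in> X (k - 1)" "y \<in> X (k - 1)" and "T \<in> P" for x y T
  proof -
    have "T \<in> settled W k" using \<open>T \<in> P\<close> P(2) by blast
    then obtain r where r: "1 \<le> r" "r \<le> k - 1" "T \<in> W r"
      unfolding settled_def by auto
    from r have "X (k - 1) \<subseteq> X r" using scheme_antimono[OF assms(2)] by simp
    then have "x \<in> X r" "y \<in> X r" using xy by blast+
    moreover have "T \<in> fixed_coalitions A v u (X r)" using W[of r] r by auto
    ultimately show ?thesis using payoff_constant_if_fixed[OF assms(1)] by blast
  qed
  then have "payoff x S = payoff y S" if "x \<in> X (k - 1)" "y \<in> X (k - 1)" for x y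
    unfolding payoff_partition[OF P(1)] using that by (intro sum.cong refl)
  then have "S \<in> fixed_coalitions A v u (X (k - 1))" by (rule fixed_if_payoff_constant[OF S])
  then have "S \<in> W (k - 1)" using W[of "k - 1"] assms(3) by simp
  then show ?thesis using assms(3) unfolding settled_def by auto
qed

lemma u_essential_subset: "u_essential A v u \<subseteq> proper A"
  by (auto simp: u_essential_def)

lemma sublevel_antimono: "C \<subseteq> D \<Longrightarrow> sublevel v u Z D s \<subseteq> sublevel v u Z C s"
  by (auto simp: sublevel_def)

theorem theorem29:
  fixes A :: "'n::finite set set"
    and v :: "'n set \<Rightarrow> real"
    and u :: "'n set \<Rightarrow> real \<Rightarrow> real"
    and t :: "nat \<Rightarrow> real"
    and X :: "nat \<Rightarrow> (real ^ 'n) set"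
    and W :: "nat \<Rightarrow> 'n set set"
    and k :: nat
  assumes "feasible_family A"
    and "v {} = 0"
    and "utility A u"
    and "u_balanced A v u"
    and "1 \<le> k"
    and "scheme A v u t X W k"
  shows "X k = essential_set A v u t X W k"
proof -
  have min: "is_minimum (t 1)
      (utility_range A u \<inter> feasible_levels v u (preimputations v) (proper A))"
    and X1: "X 1 = sublevel v u (preimputations v) (proper A) (t 1)"
    using assms(5,6) unfolding scheme_def by auto
  have "t 1 \<le> 0" using first_level_nonpos[OF assms(1,3,4) min] .
  show ?thesis
  proof (cases "k = 1")
    case True
    obtain y where "y \<in> sublevel v u (preimputations v) (proper A) (t 1)"
      using min unfolding is_minimum_def feasible_levels_def sublevel_def by blast
    moreover have "t 1 \<in> utility_range A u" using min by (simp add: is_minimum_def)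
    ultimately have "sublevel v u (preimputations v) (u_essential A v u) (t 1)
        \<subseteq> sublevel v u (preimputations v) (proper A) (t 1)"
      using essential_constraints_suffice[OF assms(3) _ \<open>t 1 \<le> 0\<close>] by blast
    moreover have "sublevel v u (preimputations v) (proper A) (t 1)
        \<subseteq> sublevel v u (preimputations v) (u_essential A v u) (t 1)"
      by (rule sublevel_antimono[OF u_essential_subset])
    ultimately show ?thesis unfolding True X1 essential_set_def by simp
  next
    case False
    then have "2 \<le> k" using assms(5) by simp
    then have Xk: "X k = sublevel v u (X (k - 1)) (proper A - settled W k) (t k)"
      using assms(6) unfolding scheme_def by auto
    have "X (k - 1) \<subseteq> X 1" using scheme_antimono[OF assms(6)] \<open>2 \<le> k\<close> by simp
    also have "X 1 \<subseteq> u_core A v u"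
      unfolding X1 u_core_def sublevel_def preimputations_def using \<open>t 1 \<le> 0\<close> by force
    finally have core: "X (k - 1) \<subseteq> u_core A v u" .
    have "sublevel v u (X (k - 1)) (u_essential A v u - settled W k) (t k) \<subseteq> X k"
    proof
      fix x assume x: "x \<in> sublevel v u (X (k - 1)) (u_essential A v u - settled W k) (t k)"
      then have "x \<in> X (k - 1)" and "x \<in> u_core A v u"
        and ess: "\<forall>S\<in>u_essential A v u - settled W k. u S (excess v S x) \<le> t k"
        using core by (auto simp: sublevel_def)
      have "u S (excess v S x) \<le> t k" if "S \<in> proper A - settled W k" for S
        using \<open>x \<in> u_core A v u\<close> ess settled_if_partitioned[OF assms(3,6) \<open>2 \<le> k\<close>] that
        by (rule essential_constraints_suffice_in_core)
      with \<open>x \<in> X (k - 1)\<close> show "x \<in> X k" unfolding Xk sublevel_def by blast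
    qed
    moreover have "X k \<subseteq> sublevel v u (X (k - 1)) (u_essential A v u - settled W k) (t k)"
      unfolding Xk by (intro sublevel_antimono Diff_mono u_essential_subset order_refl)
    ultimately show ?thesis using False by (auto simp: essential_set_def)
  qed
qed

end
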